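(* Let $\mathbf{X}=(X_1,\ldots,X_d)$ be an $\mathbb{R}^d$-valued random vector that is (positively) associated, and let $X_0$ be a real-valued (univariate) random variable that is independent of $\mathbf{X}$. Let $\mathbf{1}=(1,\ldots,1)^T\in\mathbb{R}^d$. Then the random vector $X_0\mathbf{1}+\mathbf{X}=(X_0+X_1,\ldots,X_0+X_d)$ is (positively) associated.
   Context: A function $f:\mathbb{R}^d\to\mathbb{R}$ is called increasing if $x_i\le x_i'$ for all $1\le i\le d$ implies $f(\mathbf{x})\le f(\mathbf{x}')$. An $\mathbb{R}^d$-valued random vector $\mathbf{X}$ is called (positively) associated if for all increasing functions $f,g:\mathbb{R}^d\to\mathbb{R}$ it holds that $\operatorname{Cov}(f(\mathbf{X}),g(\mathbf{X}))\ge 0$ whenever the covariance exists. *)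

theory Defs
  imports "HOL-Probability.Probability"
begin

context prob_space
begin

definition covariance :: "('a \<Rightarrow> real) \<Rightarrow> ('a \<Rightarrow> real) \<Rightarrow> real" where
  "covariance U V = expectation (\<lambda>\<omega>. (U \<omega> - expectation U) * (V \<omega> - expectation V))"

definition covariance_exists :: "('a \<Rightarrow> real) \<Rightarrow> ('a \<Rightarrow> real) \<Rightarrow> bool" where
  "covariance_exists U V \<longleftrightarrow>
     integrable M U \<and> integrable M V \<and> integrable M (\<lambda>\<omega>. U \<omega> * V \<omega>)"

(* The order on real ^ 'n is componentwise, so mono f says that f is increasing in the
   multivariate sense.  For CARD('n) > 1 an increasing function need not be Borel measurable
   (it is arbitrary on antichains), so the test functions are explicitly taken Borel. *)
definition associated :: "('a \<Rightarrow> real ^ 'n) \<Rightarrow> bool" where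
  "associated X \<longleftrightarrow> random_variable borel X \<and>
     (\<forall>f g :: real ^ 'n \<Rightarrow> real.
        f \<in> borel_measurable borel \<longrightarrow> g \<in> borel_measurable borel \<longrightarrow>
        mono f \<longrightarrow> mono g \<longrightarrow>
        covariance_exists (\<lambda>\<omega>. f (X \<omega>)) (\<lambda>\<omega>. g (X \<omega>)) \<longrightarrow>
        0 \<le> covariance (\<lambda>\<omega>. f (X \<omega>)) (\<lambda>\<omega>. g (X \<omega>)))"

(* indep_var requires both variables to have the same codomain type; this is its unfolding
   for variables with possibly different codomains. *)
definition indep_rv :: "'b measure \<Rightarrow> ('a \<Rightarrow> 'b) \<Rightarrow> 'c measure \<Rightarrow> ('a \<Rightarrow> 'c) \<Rightarrow> bool" where
  "indep_rv S X T Y \<longleftrightarrow> random_variable S X \<and> random_variable T Y \<and>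
     indep_set {X -` A \<inter> space M | A. A \<in> sets S} {Y -` B \<inter> space M | B. B \<in> sets T}"

end

end

theory Submission
  imports Defs
begin

text \<open>
  Write \<open>F(t, x) = f(t1 + x)\<close>, \<open>G(t, x) = g(t1 + x)\<close> for increasing \<open>f, g\<close>. By independence the
  expectations become integrals over \<open>t\<close> and \<open>x\<close> separately. For fixed \<open>t\<close> both functions are
  increasing in \<open>x\<close>, so association of \<open>X\<close> applies to the \<open>x\<close>-integral. It leaves the means
  \<open>\<phi>(t) = E F(t, X)\<close> and \<open>\<gamma>(t) = E G(t, X)\<close>, which are increasing in \<open>t\<close>, and one real random
  variable is always associated (Chebyshev). In the usual decomposition
  \<open>Cov(F, G) = E Cov(F, G | X0) + Cov(\<phi>(X0), \<gamma>(X0))\<close> one would have to show that \<open>\<phi> \<gamma>\<close> is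
  integrable, which is not a direct consequence of the integrability of \<open>F\<close>, \<open>G\<close> and \<open>F G\<close>.

  Centring at well-chosen constants avoids this. With \<open>a = E F\<close>, the covariance of \<open>F\<close> and \<open>G\<close>
  equals \<open>E (F - a) (G - b)\<close> for every constant \<open>b\<close>. Given \<open>t\<close>, association bounds the conditional
  expectation of this product from below by \<open>(\<phi>(t) - a) (\<gamma>(t) - b)\<close>. If \<open>b\<close> is the level of \<open>\<gamma>\<close> at
  the place where \<open>\<phi>\<close> crosses its mean \<open>a\<close>, both factors change sign at the same place, so the
  bound is nonnegative for almost every \<open>t\<close> (lemma \<open>nonneg_product_of_centred_mono\<close>, which also
  treats the degenerate case of an almost surely constant \<open>\<phi>\<close>). Integrating over \<open>t\<close> finishes the
  proof.
\<close>

text \<open>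
  Every point where \<open>\<phi>\<close> is below \<open>a\<close> lies to the left of every point where \<open>\<phi>\<close> is above \<open>a\<close>, so any
  level \<open>b\<close> between the values of \<open>\<gamma>\<close> on these two sets gives both factors the same sign. That
  neither set is empty matters: if \<open>\<phi> > a\<close> on all of \<open>S\<close> and \<open>\<gamma>\<close> is unbounded below, there is no
  such \<open>b\<close>.
\<close>

lemma mono_on_crossing_level:
  fixes \<phi> \<gamma> :: "'t::linorder \<Rightarrow> real"
  assumes "mono_on S \<phi>" "mono_on S \<gamma>"
    and "s \<in> S" "\<phi> s < a" "u \<in> S" "a < \<phi> u"
  obtains b where "\<And>t. t \<in> S \<Longrightarrow> 0 \<le> (\<phi> t - a) * (\<gamma> t - b)"
proof -
  let ?L = "{t \<in> S. \<phi> t < a}"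
  have le: "\<gamma> t \<le> \<gamma> t'" if "t \<in> ?L" "t' \<in> S" "a < \<phi> t'" for t t'
  proof -
    have "t \<le> t'"
      using that mono_onD[OF assms(1), of t' t] by force
    then show ?thesis
      using that mono_onD[OF assms(2)] by auto
  qed
  define b where "b = (SUP t\<in>?L. \<gamma> t)"
  have bdd: "bdd_above (\<gamma> ` ?L)"
    using le assms by (auto intro!: bdd_aboveI)
  have lower: "\<gamma> t \<le> b" if "t \<in> ?L" for t
    unfolding b_def using bdd that by (intro cSUP_upper)
  have upper: "b \<le> \<gamma> t" if "t \<in> S" "a < \<phi> t" for t
    unfolding b_def using le that assms by (intro cSUP_least) auto
  have "0 \<le> (\<phi> t - a) * (\<gamma> t - b)" if "t \<in> S" for t
    using that lower[of t] upper[of t]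
    by (cases "\<phi> t" a rule: linorder_cases)
       (auto intro: mult_nonneg_nonneg mult_nonpos_nonpos)
  then show thesis
    using that by blast
qed

text \<open>
  Centring \<open>\<phi>\<close> at its mean makes the crossing level exist: a function that stays on one side of its
  mean is almost surely constant, and then the product vanishes for any \<open>b\<close>. Monotonicity is
  required on a set of full measure only, since the conditional means to which the lemma will be
  applied are meaningful only almost everywhere.
\<close>

lemma nonneg_product_of_centred_mono:
  fixes M :: "'t::linorder measure" and \<phi> \<gamma> :: "'t \<Rightarrow> real"
  assumes "prob_space M" and int: "integrable M \<phi>" and S: "AE t in M. t \<in> S"
    and mono: "mono_on S \<phi>" "mono_on S \<gamma>"
  obtains b where "AE t in M. 0 \<le> (\<phi> t - integral\<^sup>L M \<phi>) * (\<gamma> t - b)"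
proof -
  interpret prob_space M by fact
  let ?a = "expectation \<phi>"
  have centred: "integrable M (\<lambda>t. \<phi> t - ?a)" "expectation (\<lambda>t. \<phi> t - ?a) = 0"
      "integrable M (\<lambda>t. ?a - \<phi> t)" "expectation (\<lambda>t. ?a - \<phi> t) = 0"
    using int by (auto simp: prob_space)
  consider (cross) s u where "s \<in> S" "\<phi> s < ?a" "u \<in> S" "?a < \<phi> u"
    | (above) "\<And>t. t \<in> S \<Longrightarrow> 0 \<le> \<phi> t - ?a"
    | (below) "\<And>t. t \<in> S \<Longrightarrow> 0 \<le> ?a - \<phi> t"
    by force
  then show thesis
  proof cases
    case cross
    then obtain b where "\<And>t. t \<in> S \<Longrightarrow> 0 \<le> (\<phi> t - ?a) * (\<gamma> t - b)"
      using mono_on_crossing_level[OF mono] by blast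
    then show thesis
      using S by (intro that[of b]) auto
  next
    case above
    then have "AE t in M. 0 \<le> \<phi> t - ?a"
      using S by auto
    then have "AE t in M. \<phi> t - ?a = 0"
      using integral_nonneg_eq_0_iff_AE[OF centred(1)] centred(2) by simp
    then show thesis
      by (intro that[of 0]) auto
  next
    case below
    then have "AE t in M. 0 \<le> ?a - \<phi> t"
      using S by auto
    then have "AE t in M. ?a - \<phi> t = 0"
      using integral_nonneg_eq_0_iff_AE[OF centred(3)] centred(4) by simp
    then show thesis
      by (intro that[of 0]) auto
  qed
qed

text \<open>
  The correction term vanishes as soon as one of the two constants is the corresponding mean, so the
  other constant can be chosen freely.
\<close>

lemma (in prob_space) covariance_shift:
  assumes "covariance_exists U V"
  shows "covariance U V =
    expectation (\<lambda>\<omega>. (U \<omega> - a) * (V \<omega> - b)) - (expectation U - a) * (expectation V - b)"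
proof -
  have [simp]: "integrable M U" "integrable M V" "integrable M (\<lambda>\<omega>. U \<omega> * V \<omega>)"
    using assms by (auto simp: covariance_exists_def)
  have expand: "expectation (\<lambda>\<omega>. (U \<omega> - c) * (V \<omega> - d)) =
    expectation (\<lambda>\<omega>. U \<omega> * V \<omega>) - d * expectation U - c * expectation V + c * d" for c d
  proof -
    have "expectation (\<lambda>\<omega>. (U \<omega> - c) * (V \<omega> - d)) =
      expectation (\<lambda>\<omega>. U \<omega> * V \<omega> - d * U \<omega> - c * V \<omega> + c * d)"
      by (simp add: algebra_simps)
    also have "\<dots> = expectation (\<lambda>\<omega>. U \<omega> * V \<omega>) - d * expectation U - c * expectation V + c * d"
      by (simp add: prob_space)
    finally show ?thesis .
  qed
  show ?thesis
    unfolding covariance_def expand by (simp add: algebra_simps)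
qed

lemma (in prob_space) distr_pair_eq_pair_distr:
  assumes "indep_rv S X T Y"
  shows "distr M (S \<Otimes>\<^sub>M T) (\<lambda>\<omega>. (X \<omega>, Y \<omega>)) = distr M S X \<Otimes>\<^sub>M distr M T Y"
proof -
  have [measurable]: "X \<in> measurable M S" "Y \<in> measurable M T"
    and ind: "indep_set {X -` A \<inter> space M | A. A \<in> sets S} {Y -` B \<inter> space M | B. B \<in> sets T}"
    using assms by (auto simp: indep_rv_def)
  interpret X: prob_space "distr M S X" by (rule prob_space_distr) measurable
  interpret Y: prob_space "distr M T Y" by (rule prob_space_distr) measurable
  show ?thesis
  proof (rule sym, rule pair_measure_eqI)
    show "sigma_finite_measure (distr M S X)" "sigma_finite_measure (distr M T Y)"
      by unfold_locales
    show "sets (distr M S X \<Otimes>\<^sub>M distr M T Y) =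
        sets (distr M (S \<Otimes>\<^sub>M T) (\<lambda>\<omega>. (X \<omega>, Y \<omega>)))"
      by (simp cong: sets_pair_measure_cong)
    fix A B assume "A \<in> sets (distr M S X)" "B \<in> sets (distr M T Y)"
    then have [measurable]: "A \<in> sets S" "B \<in> sets T" by simp_all
    have "prob ((X -` A \<inter> space M) \<inter> (Y -` B \<inter> space M)) =
        prob (X -` A \<inter> space M) * prob (Y -` B \<inter> space M)"
      by (intro indep_setD[OF ind]) auto
    moreover have "(\<lambda>\<omega>. (X \<omega>, Y \<omega>)) -` (A \<times> B) \<inter> space M =
        (X -` A \<inter> space M) \<inter> (Y -` B \<inter> space M)"
      by auto
    ultimately show "emeasure (distr M S X) A * emeasure (distr M T Y) B =
        emeasure (distr M (S \<Otimes>\<^sub>M T) (\<lambda>\<omega>. (X \<omega>, Y \<omega>))) (A \<times> B)"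
      by (simp add: emeasure_distr emeasure_eq_measure ennreal_mult)
  qed
qed

text \<open>
  This is the use of association for a fixed value of the common shift: translating by \<open>v\<close> preserves
  monotonicity, and the inequality says that the covariance of the translated functions is
  nonnegative, rewritten for arbitrary centring constants.
\<close>

lemma (in prob_space) associated_shifted_product_ge:
  fixes X :: "'a \<Rightarrow> real ^ 'n" and f g :: "real ^ 'n \<Rightarrow> real"
  assumes "associated X"
    and [measurable]: "f \<in> borel_measurable borel" "g \<in> borel_measurable borel"
    and "mono f" "mono g"
    and ex: "covariance_exists (\<lambda>\<omega>. f (v + X \<omega>)) (\<lambda>\<omega>. g (v + X \<omega>))"
  shows "(expectation (\<lambda>\<omega>. f (v + X \<omega>)) - a) * (expectation (\<lambda>\<omega>. g (v + X \<omega>)) - b)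
    \<le> expectation (\<lambda>\<omega>. (f (v + X \<omega>) - a) * (g (v + X \<omega>) - b))"
proof -
  have "mono (\<lambda>x. f (v + x))" "mono (\<lambda>x. g (v + x))"
    using \<open>mono f\<close> \<open>mono g\<close> by (auto simp: mono_def less_eq_vec_def)
  moreover have "(\<lambda>x. f (v + x)) \<in> borel_measurable borel" "(\<lambda>x. g (v + x)) \<in> borel_measurable borel"
    by measurable
  ultimately have "0 \<le> covariance (\<lambda>\<omega>. f (v + X \<omega>)) (\<lambda>\<omega>. g (v + X \<omega>))"
    using assms(1) ex unfolding associated_def by blast
  then show ?thesis
    using covariance_shift[OF ex, of a b] by simp
qed

theorem proposition3:
  fixes M :: "'a measure"
    and X :: "'a \<Rightarrow> real ^ 'n"
    and X0 :: "'a \<Rightarrow> real"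
  assumes "prob_space M"
    and "prob_space.associated M X"
    and "prob_space.indep_rv M borel X0 borel X"
  shows "prob_space.associated M (\<lambda>\<omega>. X0 \<omega> *\<^sub>R 1 + X \<omega>)"
proof -
  interpret prob_space M by fact
  note assoc = assms(2) and ind = assms(3)
  have [measurable]: "X0 \<in> borel_measurable M" "X \<in> borel_measurable M"
    using ind by (auto simp: indep_rv_def)
  define P where "P = distr M borel X0"
  define Q where "Q = distr M borel X"
  have [measurable_cong]: "sets P = sets borel" "sets Q = sets borel"
    by (auto simp: P_def Q_def)
  interpret P: prob_space P unfolding P_def by (rule prob_space_distr) measurable
  interpret Q: prob_space Q unfolding Q_def by (rule prob_space_distr) measurable
  interpret PQ: pair_prob_space P Q ..
  have joint: "P \<Otimes>\<^sub>M Q = distr M (borel \<Otimes>\<^sub>M borel) (\<lambda>\<omega>. (X0 \<omega>, X \<omega>))"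
    unfolding P_def Q_def by (rule distr_pair_eq_pair_distr[OF ind, symmetric])
  show ?thesis
    unfolding associated_def
  proof (intro conjI allI impI)
    show "(\<lambda>\<omega>. X0 \<omega> *\<^sub>R 1 + X \<omega>) \<in> borel_measurable M"
      by measurable
    fix f g :: "real ^ 'n \<Rightarrow> real"
    assume [measurable]: "f \<in> borel_measurable borel" "g \<in> borel_measurable borel"
      and mono: "mono f" "mono g"
      and ex: "covariance_exists (\<lambda>\<omega>. f (X0 \<omega> *\<^sub>R 1 + X \<omega>)) (\<lambda>\<omega>. g (X0 \<omega> *\<^sub>R 1 + X \<omega>))"
    define F where "F = (\<lambda>(t, x). f (t *\<^sub>R 1 + x))"
    define G where "G = (\<lambda>(t, x). g (t *\<^sub>R 1 + x))"
    have [measurable]: "F \<in> borel_measurable (borel \<Otimes>\<^sub>M borel)"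
        "G \<in> borel_measurable (borel \<Otimes>\<^sub>M borel)"
      unfolding F_def G_def by measurable
    have int: "integrable (P \<Otimes>\<^sub>M Q) F" "integrable (P \<Otimes>\<^sub>M Q) G"
        "integrable (P \<Otimes>\<^sub>M Q) (\<lambda>z. F z * G z)"
      using ex unfolding joint covariance_exists_def
      by (simp_all add: integrable_distr_eq F_def G_def)
    (* Fubini provides these integrabilities for almost every t only; outside S the inner integrals
       may take the default value 0, which would break monotonicity in t. *)
    define S where "S = {t. integrable Q (\<lambda>x. F (t, x)) \<and> integrable Q (\<lambda>x. G (t, x)) \<and>
      integrable Q (\<lambda>x. F (t, x) * G (t, x))}"
    have S: "AE t in P. t \<in> S"
      using PQ.AE_integrable_fst'[OF int(1)] PQ.AE_integrable_fst'[OF int(2)]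
        PQ.AE_integrable_fst'[OF int(3)]
      unfolding S_def by eventually_elim simp
    define \<phi> where "\<phi> = (\<lambda>t. \<integral>x. F (t, x) \<partial>Q)"
    define \<gamma> where "\<gamma> = (\<lambda>t. \<integral>x. G (t, x) \<partial>Q)"
    have shift_le: "s *\<^sub>R 1 + x \<le> t *\<^sub>R 1 + x" if "s \<le> t" for s t and x :: "real ^ 'n"
      using that by (simp add: less_eq_vec_def)
    have "mono_on S \<phi>" "mono_on S \<gamma>"
      using mono shift_le unfolding \<phi>_def \<gamma>_def S_def
      by (auto intro!: mono_onI integral_mono simp: F_def G_def mono_def)
    moreover have "integrable P \<phi>"
      unfolding \<phi>_def by (rule PQ.integrable_fst'[OF int(1)])
    ultimately obtain b where b: "AE t in P. 0 \<le> (\<phi> t - P.expectation \<phi>) * (\<gamma> t - b)"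
      using nonneg_product_of_centred_mono[OF P.prob_space_axioms _ S] by blast
    define a where "a = P.expectation \<phi>"
    have mean: "expectation (\<lambda>\<omega>. f (X0 \<omega> *\<^sub>R 1 + X \<omega>)) = a"
      using PQ.integral_fst'[OF int(1)] unfolding a_def \<phi>_def
      by (simp add: joint integral_distr) (simp add: F_def)
    let ?H = "\<lambda>z. (F z - a) * (G z - b)"
    have intH: "integrable (P \<Otimes>\<^sub>M Q) ?H"
    proof -
      have "?H = (\<lambda>z. F z * G z - b * F z - a * G z + a * b)"
        by (auto simp: algebra_simps)
      then show ?thesis
        using int by simp
    qed
    have inner: "(\<phi> t - a) * (\<gamma> t - b) \<le> (\<integral>x. ?H (t, x) \<partial>Q)" if "t \<in> S" for t
    proof -
      have "covariance_exists (\<lambda>\<omega>. f (t *\<^sub>R 1 + X \<omega>)) (\<lambda>\<omega>. g (t *\<^sub>R 1 + X \<omega>))"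
        using that unfolding covariance_exists_def S_def Q_def
        by (simp add: integrable_distr_eq F_def G_def)
      from associated_shifted_product_ge[OF assoc _ _ mono this, of a b]
      show ?thesis
        unfolding \<phi>_def \<gamma>_def Q_def by (simp add: integral_distr F_def G_def)
    qed
    have "AE t in P. 0 \<le> (\<integral>x. ?H (t, x) \<partial>Q)"
      using S b
    proof eventually_elim
      case (elim t)
      then show ?case
        using inner[of t] by (simp add: a_def)
    qed
    then have "0 \<le> (\<integral>t. (\<integral>x. ?H (t, x) \<partial>Q) \<partial>P)"
      by (rule integral_nonneg_AE)
    also have "\<dots> = (\<integral>z. ?H z \<partial>(P \<Otimes>\<^sub>M Q))"
      by (rule PQ.integral_fst'[OF intH])
    also have "\<dots> = expectation (\<lambda>\<omega>. (f (X0 \<omega> *\<^sub>R 1 + X \<omega>) - a) * (g (X0 \<omega> *\<^sub>R 1 + X \<omega>) - b))"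
      by (simp add: joint integral_distr) (simp add: F_def G_def)
    also have "\<dots> = covariance (\<lambda>\<omega>. f (X0 \<omega> *\<^sub>R 1 + X \<omega>)) (\<lambda>\<omega>. g (X0 \<omega> *\<^sub>R 1 + X \<omega>))"
      using covariance_shift[OF ex, of a b] mean by simp
    finally show "0 \<le> covariance (\<lambda>\<omega>. f (X0 \<omega> *\<^sub>R 1 + X \<omega>)) (\<lambda>\<omega>. g (X0 \<omega> *\<^sub>R 1 + X \<omega>))" .
  qed
qed

end
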